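(* Let $\mathbb F$ be a field of characteristic not $2$. For $i=1,\dots,k$ let $\mathcal U_i$ be a vector space over $\mathbb F$ with $\dim_{\mathbb F}\mathcal U_i=m_i$ and basis $\{u_{i1},\dots,u_{im_i}\}$. For $i=1,\dots,k-1$ let $\xi_i:\mathcal U_i\otimes\mathcal U_i\to\mathcal U_{i+1}$ be a symmetric bilinear mapping such that $\xi_i(u_{ip},u_{iq})=0$ for $p\ne q$. Then the algebra $\mathbb E=\mathcal U_1\times\mathcal U_2\times\dots\times\mathcal U_k$ with multiplication $$(x_1,x_2,\dots,x_k)(y_1,y_2,\dots,y_k)=\bigl(0,\xi_1(x_1,y_1),\xi_2(x_2,y_2),\dots,\xi_{k-1}(x_{k-1},y_{k-1})\bigr),\qquad x_i,y_i\in\mathcal U_i,$$ is a nilpotent evolution algebra of type $[n_1,n_2,\dots,n_k]$ with $n_i=m_{k-i+1}$.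
   Context: An algebra over a field is not assumed associative or unital. An evolution algebra over a field is an algebra admitting a basis $\{e_i\}$ (a natural basis) such that $e_ie_j=0$ whenever $i\ne j$ (each $e_i^2$ being an arbitrary linear combination of basis elements). For an evolution algebra $E$ put $E^1=E$ and $E^m=\sum_{i=1}^{m-1}E^iE^{m-i}$ for $m\ge2$; $E$ is nilpotent if $E^m=0$ for some $m\in\mathbb N$. For an algebra $\mathcal A$ define $\operatorname{ann}^0(\mathcal A)=0$, $\operatorname{ann}^1(\mathcal A)=\operatorname{ann}(\mathcal A)=\{x\in\mathcal A: x\mathcal A=\mathcal A x=0\}$, and $\operatorname{ann}^i(\mathcal A)$ by $\operatorname{ann}^i(\mathcal A)/\operatorname{ann}^{i-1}(\mathcal A)=\operatorname{ann}(\mathcal A/\operatorname{ann}^{i-1}(\mathcal A))$. If $\mathcal A$ is finite-dimensional and nilpotent and $s$ is the lowest natural number with $\operatorname{ann}^s(\mathcal A)=\mathcal A$, the type of $\mathcal A$ is the sequence $[n_1,\dots,n_s]$ with $n_i=\dim_{\mathbb F}\operatorname{ann}^i(\mathcal A)-\dim_{\mathbb F}\operatorname{ann}^{i-1}(\mathcal A)$.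
   Formalization: The type claim is stated only when m_1 ≥ 1 and every ξ_i is nondegenerate (only x = 0 has ξ_i(x,y) = 0 for all y in U_i); without this it fails, e.g. k = 2, m_1 = m_2 = 1, ξ_1 = 0 has type [2], not [1,1]. Nilpotent and evolution are claimed in full. *)

theory Defs
  imports
    "HOL-Computational_Algebra.Computational_Algebra"
    "HOL-Library.Function_Algebras"
    "HOL-Library.Set_Algebras"
begin

text \<open>
  Vector spaces over the field \<^typ>\<open>'f\<close> are carrier sets (subspaces) inside an ambient type with a
  scalar multiplication \<open>s\<close> satisfying \<open>vector_space s\<close>. This loses no generality for a family of
  spaces \<open>U i\<close>: they all embed into their direct sum.
\<close>

definition is_basis :: "('f::field \<Rightarrow> 'v::ab_group_add \<Rightarrow> 'v) \<Rightarrow> 'v set \<Rightarrow> 'v set \<Rightarrow> bool" where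
  "is_basis s V B \<longleftrightarrow> \<not> module.dependent s B \<and> module.span s B = V"

definition finite_dimensional :: "('f::field \<Rightarrow> 'v::ab_group_add \<Rightarrow> 'v) \<Rightarrow> 'v set \<Rightarrow> bool" where
  "finite_dimensional s V \<longleftrightarrow> (\<exists>B. finite B \<and> is_basis s V B)"

definition bilinear_map ::
  "('f::field \<Rightarrow> 'v::ab_group_add \<Rightarrow> 'v) \<Rightarrow> 'v set \<Rightarrow> 'v set \<Rightarrow> ('v \<Rightarrow> 'v \<Rightarrow> 'v) \<Rightarrow> bool" where
  "bilinear_map s V W b \<longleftrightarrow>
     (\<forall>x\<in>V. \<forall>y\<in>V. b x y \<in> W) \<and>
     (\<forall>x\<in>V. \<forall>y\<in>V. \<forall>z\<in>V. b (x + y) z = b x z + b y z \<and> b z (x + y) = b z x + b z y) \<and>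
     (\<forall>c. \<forall>x\<in>V. \<forall>y\<in>V. b (s c x) y = s c (b x y) \<and> b x (s c y) = s c (b x y))"

definition symmetric_map :: "'v set \<Rightarrow> ('v \<Rightarrow> 'v \<Rightarrow> 'v) \<Rightarrow> bool" where
  "symmetric_map V b \<longleftrightarrow> (\<forall>x\<in>V. \<forall>y\<in>V. b x y = b y x)"

text \<open>
  The radical is trivial; used for symmetric maps only, so one side suffices. If \<open>b x y = 0\<close> for distinct
  members of a basis, this says that \<open>b x x \<noteq> 0\<close> for every basis member \<open>x\<close>. The dimension formula for
  the annihilator series needs it: with all maps zero the product algebra is its own annihilator,
  so its type has a single entry.
\<close>

definition nondegenerate :: "'v::zero set \<Rightarrow> ('v \<Rightarrow> 'v \<Rightarrow> 'v) \<Rightarrow> bool" where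
  "nondegenerate V b \<longleftrightarrow> (\<forall>x\<in>V. (\<forall>y\<in>V. b x y = 0) \<longrightarrow> x = 0)"

definition is_algebra ::
  "('f::field \<Rightarrow> 'v::ab_group_add \<Rightarrow> 'v) \<Rightarrow> 'v set \<Rightarrow> ('v \<Rightarrow> 'v \<Rightarrow> 'v) \<Rightarrow> bool" where
  "is_algebra s A mul \<longleftrightarrow> vector_space s \<and> module.subspace s A \<and> bilinear_map s A A mul"

definition evolution_algebra ::
  "('f::field \<Rightarrow> 'v::ab_group_add \<Rightarrow> 'v) \<Rightarrow> 'v set \<Rightarrow> ('v \<Rightarrow> 'v \<Rightarrow> 'v) \<Rightarrow> bool" where
  "evolution_algebra s A mul \<longleftrightarrow>
     is_algebra s A mul \<and>
     (\<exists>B. is_basis s A B \<and> (\<forall>x\<in>B. \<forall>y\<in>B. x \<noteq> y \<longrightarrow> mul x y = 0))"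

definition subspace_prod ::
  "('f::field \<Rightarrow> 'v::ab_group_add \<Rightarrow> 'v) \<Rightarrow> ('v \<Rightarrow> 'v \<Rightarrow> 'v) \<Rightarrow> 'v set \<Rightarrow> 'v set \<Rightarrow> 'v set" where
  "subspace_prod s mul X Y = module.span s {mul x y | x y. x \<in> X \<and> y \<in> Y}"

text \<open>
  The powers are indexed from 1; the value at 0 is a dummy. A sum of subspaces is the span of their
  union.
\<close>

fun alg_power ::
  "('f::field \<Rightarrow> 'v::ab_group_add \<Rightarrow> 'v) \<Rightarrow> 'v set \<Rightarrow> ('v \<Rightarrow> 'v \<Rightarrow> 'v) \<Rightarrow> nat \<Rightarrow> 'v set" where
  "alg_power s A mul m =
     (if m \<le> 1 then A
      else module.span s
        (\<Union>i\<in>{1..<m}. subspace_prod s mul (alg_power s A mul i) (alg_power s A mul (m - i))))"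

declare alg_power.simps [simp del]

definition nilpotent_algebra ::
  "('f::field \<Rightarrow> 'v::ab_group_add \<Rightarrow> 'v) \<Rightarrow> 'v set \<Rightarrow> ('v \<Rightarrow> 'v \<Rightarrow> 'v) \<Rightarrow> bool" where
  "nilpotent_algebra s A mul \<longleftrightarrow> (\<exists>m\<ge>1. alg_power s A mul m = {0})"

text \<open>
  The zero element is a parameter, so that the annihilator applies also to a quotient, whose
  elements are cosets.
\<close>

definition annihilator :: "'b set \<Rightarrow> ('b \<Rightarrow> 'b \<Rightarrow> 'b) \<Rightarrow> 'b \<Rightarrow> 'b set" where
  "annihilator A mul z = {x\<in>A. \<forall>y\<in>A. mul x y = z \<and> mul y x = z}"

definition quot_carrier :: "'v::ab_group_add set \<Rightarrow> 'v set \<Rightarrow> 'v set set" where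
  "quot_carrier A I = (\<lambda>x. x +o I) ` A"

text \<open>For an ideal \<open>I\<close> the product of the cosets of \<open>x\<close> and \<open>y\<close> is the coset of \<open>mul x y\<close>.\<close>

definition quot_mult ::
  "('v::ab_group_add \<Rightarrow> 'v \<Rightarrow> 'v) \<Rightarrow> 'v set \<Rightarrow> 'v set \<Rightarrow> 'v set \<Rightarrow> 'v set" where
  "quot_mult mul I X Y = (\<Union>x\<in>X. \<Union>y\<in>Y. mul x y +o I)"

text \<open>
  \<open>ann_series A mul (Suc i)\<close> is the preimage in \<open>A\<close> of the annihilator of the quotient of \<open>A\<close> by
  \<open>I = ann_series A mul i\<close>; the zero of that quotient is \<open>I\<close> itself.
\<close>

primrec ann_series ::
  "'v::ab_group_add set \<Rightarrow> ('v \<Rightarrow> 'v \<Rightarrow> 'v) \<Rightarrow> nat \<Rightarrow> 'v set" where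
  "ann_series A mul 0 = {0}"
| "ann_series A mul (Suc i) =
     {x\<in>A. x +o ann_series A mul i \<in>
        annihilator (quot_carrier A (ann_series A mul i)) (quot_mult mul (ann_series A mul i))
          (ann_series A mul i)}"

text \<open>The series is increasing, so the subtraction of dimensions does not truncate.\<close>

definition has_type ::
  "('f::field \<Rightarrow> 'v::ab_group_add \<Rightarrow> 'v) \<Rightarrow> 'v set \<Rightarrow> ('v \<Rightarrow> 'v \<Rightarrow> 'v) \<Rightarrow> nat list \<Rightarrow> bool" where
  "has_type s A mul ns \<longleftrightarrow>
     is_algebra s A mul \<and> finite_dimensional s A \<and> nilpotent_algebra s A mul \<and>
     (\<exists>r. ann_series A mul r = A \<and> (\<forall>t<r. ann_series A mul t \<noteq> A) \<and>
        ns = map (\<lambda>i. vector_space.dim s (ann_series A mul i)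
                      - vector_space.dim s (ann_series A mul (i - 1))) [1..<Suc r])"

text \<open>
  An element of the product of \<open>U 1, \<dots>, U k\<close> is a function on all indices that vanishes outside
  \<open>{1..k}\<close>.
\<close>

definition prod_scale :: "('f \<Rightarrow> 'v \<Rightarrow> 'v) \<Rightarrow> 'f \<Rightarrow> (nat \<Rightarrow> 'v) \<Rightarrow> (nat \<Rightarrow> 'v)" where
  "prod_scale s c x = (\<lambda>i. s c (x i))"

definition prod_space :: "nat \<Rightarrow> (nat \<Rightarrow> 'v::zero set) \<Rightarrow> (nat \<Rightarrow> 'v) set" where
  "prod_space k U = {x. (\<forall>i\<in>{1..k}. x i \<in> U i) \<and> (\<forall>i. i \<notin> {1..k} \<longrightarrow> x i = 0)}"

definition shift_mult ::
  "nat \<Rightarrow> (nat \<Rightarrow> 'v \<Rightarrow> 'v \<Rightarrow> 'v) \<Rightarrow> (nat \<Rightarrow> 'v::zero) \<Rightarrow> (nat \<Rightarrow> 'v) \<Rightarrow> (nat \<Rightarrow> 'v)" where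
  "shift_mult k \<xi> x y =
     (\<lambda>i. if i \<in> {2..k} then \<xi> (i - 1) (x (i - 1)) (y (i - 1)) else 0)"

end

theory Submission
  imports Defs
begin

text \<open>
  Write \<open>A\<close> for the product of \<open>U 1, \<dots>, U k\<close> and \<open>F n\<close> for the subspace of those tuples whose
  components \<open>1, \<dots>, n\<close> vanish, so that \<open>F 0 = A\<close> and \<open>F k = 0\<close>. Everything follows from one fact: the
  product moves component \<open>i\<close> to component \<open>i + 1\<close> and never mixes different components.

  \<^item> The tuples with a single nonzero component, taken from the given basis of the respective
    factor, form a natural basis: two of them in different positions have product zero because the
    product is componentwise, and two in the same position by the orthogonality of the given bases.

  \<^item> Multiplication by anything maps \<open>F n\<close> into \<open>F (n + 1)\<close>. Powers are bracketed arbitrarily, so the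
    weight of a power grows only logarithmically (\<open>E\<^sup>2 E\<^sup>2\<close> need not lie in \<open>F 3\<close>): in a product
    \<open>E\<^sup>i E\<^sup>j\<close> with \<open>i + j \<ge> 2\<^sup>n\<^sup>+\<^sup>1\<close> one of the exponents is at least \<open>2\<^sup>n\<close>, which gives
    \<open>E\<^sup>r \<subseteq> F n\<close> for \<open>r \<ge> 2\<^sup>n\<close>. The exponent \<open>2\<^sup>k\<close> therefore kills the algebra.

  \<^item> If every \<open>\<xi> i\<close> is nondegenerate and \<open>n < k\<close>, then \<open>x A\<close> lies in \<open>F (n + 1)\<close> only when \<open>x\<close> lies in
    \<open>F n\<close>. Hence the annihilator series climbs through the filtration from its small end, \<open>ann\<^sup>t = F (k - t)\<close>, and
    the dimension gained at step \<open>t\<close> is that of the factor \<open>U (k - t + 1)\<close>. The series does not reach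
    \<open>A\<close> before step \<open>k\<close> because \<open>U 1\<close> is nonzero.
\<close>

section \<open>Subspaces of tuples and their bases\<close>

definition coord_space :: "nat set \<Rightarrow> (nat \<Rightarrow> 'v::zero set) \<Rightarrow> (nat \<Rightarrow> 'v) set" where
  "coord_space J U = {x. (\<forall>i\<in>J. x i \<in> U i) \<and> (\<forall>i. i \<notin> J \<longrightarrow> x i = 0)}"

definition single :: "nat \<Rightarrow> 'v::zero \<Rightarrow> nat \<Rightarrow> 'v" where
  "single i v = (\<lambda>j. if j = i then v else 0)"

definition coord_basis :: "nat set \<Rightarrow> (nat \<Rightarrow> 'v::zero set) \<Rightarrow> (nat \<Rightarrow> 'v) set" where
  "coord_basis J B = (\<Union>i\<in>J. single i ` B i)"

lemma prod_space_eq_coord_space: "prod_space k U = coord_space {1..k} U"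
  by (simp add: prod_space_def coord_space_def)

lemma vector_space_prod_scale:
  assumes "vector_space scale"
  shows "vector_space (prod_scale scale)"
proof -
  interpret vector_space scale by fact
  show ?thesis
    by unfold_locales
      (simp_all add: prod_scale_def fun_eq_iff scale_right_distrib scale_left_distrib)
qed

lemma sum_single:
  fixes x :: "nat \<Rightarrow> 'v::ab_group_add"
  assumes "finite J" and "\<And>i. i \<notin> J \<Longrightarrow> x i = 0"
  shows "x = (\<Sum>i\<in>J. single i (x i))"
proof
  fix j
  have "(\<Sum>i\<in>J. single i (x i)) j = (\<Sum>i\<in>J. single i (x i) j)"
    using \<open>finite J\<close> by (induction rule: finite_induct) auto
  also have "\<dots> = x j"
    using assms by (simp add: single_def)
  finally show "x j = (\<Sum>i\<in>J. single i (x i)) j" ..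
qed

lemma card_coord_basis:
  fixes B :: "nat \<Rightarrow> 'a::zero set"
  assumes "finite J" and "\<And>i. i \<in> J \<Longrightarrow> finite (B i)" and "\<And>i. i \<in> J \<Longrightarrow> 0 \<notin> B i"
  shows "card (coord_basis J B) = (\<Sum>i\<in>J. card (B i))"
proof -
  have "single i ` B i \<inter> single j ` B j = {}" if "i \<in> J" "j \<in> J" "i \<noteq> j" for i j
    using assms(3)[OF that(1)] that(3) by (auto simp: single_def fun_eq_iff) metis
  moreover have "inj (single i :: 'a \<Rightarrow> nat \<Rightarrow> 'a)" for i
    by (rule injI) (metis single_def)
  then have "inj_on (single i) (B i)" for i
    by (rule inj_on_subset) simp
  ultimately show ?thesis
    unfolding coord_basis_def using assms(1,2)
    by (subst card_UN_disjoint) (auto intro!: sum.cong card_image)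
qed

context vector_space
begin

lemma subspace_coord_space:
  assumes "\<And>i. i \<in> J \<Longrightarrow> subspace (U i)"
  shows "module.subspace (prod_scale scale) (coord_space J U)"
proof -
  interpret W: vector_space "prod_scale scale"
    by (rule vector_space_prod_scale) unfold_locales
  show ?thesis
    using assms unfolding W.subspace_def
    by (auto simp: coord_space_def prod_scale_def subspace_def)
qed

text \<open>
  Independence is checked one component at a time: if \<open>single i b\<close> were a combination of the other
  members, then the component \<open>i\<close> of that combination would express \<open>b\<close> by the other members of \<open>B i\<close>.
\<close>

lemma is_basis_coord_basis:
  assumes "finite J" and basis: "\<And>i. i \<in> J \<Longrightarrow> is_basis scale (U i) (B i)"
  shows "is_basis (prod_scale scale) (coord_space J U) (coord_basis J B)"
proof -
  interpret W: vector_space "prod_scale scale"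
    by (rule vector_space_prod_scale) unfold_locales
  have indep: "independent (B i)" and span: "span (B i) = U i" if "i \<in> J" for i
    using basis[OF that] by (auto simp: is_basis_def)
  have "W.independent (coord_basis J B)"
  proof
    assume "W.dependent (coord_basis J B)"
    then obtain i b where i: "i \<in> J" and b: "b \<in> B i"
      and *: "single i b \<in> W.span (coord_basis J B - {single i b})"
      by (auto simp: W.dependent_def coord_basis_def)
    have "W.subspace {x. x i \<in> span (B i - {b})}"
      by (auto simp: W.subspace_def prod_scale_def span_zero span_add span_scale)
    moreover have "coord_basis J B - {single i b} \<subseteq> {x. x i \<in> span (B i - {b})}"
      by (auto simp: coord_basis_def single_def span_zero intro: span_base)
    ultimately have "single i b \<in> {x. x i \<in> span (B i - {b})}"
      using W.span_minimal * by blast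
    then have "b \<in> span (B i - {b})"
      by (simp add: single_def)
    with indep[OF i] b show False
      by (auto simp: dependent_def)
  qed
  moreover have "W.span (coord_basis J B) = coord_space J U"
  proof
    have "subspace (U i)" if "i \<in> J" for i
      using span[OF that] subspace_span by metis
    moreover have "coord_basis J B \<subseteq> coord_space J U"
    proof
      fix x assume "x \<in> coord_basis J B"
      then obtain i b where i: "i \<in> J" "b \<in> B i" "x = single i b"
        by (auto simp: coord_basis_def)
      moreover have "b \<in> U i" using span_base[of b "B i"] i span by simp
      moreover have "0 \<in> U j" if "j \<in> J" for j using span_zero[of "B j"] span[OF that] by simp
      ultimately show "x \<in> coord_space J U"
        by (auto simp: coord_space_def single_def)
    qed
    ultimately show "W.span (coord_basis J B) \<subseteq> coord_space J U"
      by (intro W.span_minimal subspace_coord_space)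
  next
    show "coord_space J U \<subseteq> W.span (coord_basis J B)"
    proof
      fix x assume x: "x \<in> coord_space J U"
      have "single i (x i) \<in> W.span (coord_basis J B)" if i: "i \<in> J" for i
      proof -
        let ?S = "{v. single i v \<in> W.span (coord_basis J B)}"
        have "single i 0 = (0 :: nat \<Rightarrow> 'b)"
          and "single i (v + w) = single i v + single i w"
          and "single i (scale c v) = prod_scale scale c (single i v)" for c and v w :: 'b
          by (auto simp: single_def prod_scale_def fun_eq_iff)
        then have "subspace ?S"
          by (auto simp: subspace_def W.span_zero intro: W.span_add W.span_scale)
        moreover have "B i \<subseteq> ?S"
          using i by (auto simp: coord_basis_def intro!: W.span_base)
        ultimately have "U i \<subseteq> ?S"
          using span_minimal span[OF i] by metis
        then show ?thesis
          using x i by (auto simp: coord_space_def)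
      qed
      then have "(\<Sum>i\<in>J. single i (x i)) \<in> W.span (coord_basis J B)"
        by (rule W.span_sum)
      moreover have "x = (\<Sum>i\<in>J. single i (x i))"
        using x \<open>finite J\<close> by (intro sum_single) (auto simp: coord_space_def)
      ultimately show "x \<in> W.span (coord_basis J B)"
        by metis
    qed
  qed
  ultimately show ?thesis
    by (simp add: is_basis_def)
qed

lemma dim_coord_space:
  assumes "finite J" and basis: "\<And>i. i \<in> J \<Longrightarrow> is_basis scale (U i) (B i)"
    and fin: "\<And>i. i \<in> J \<Longrightarrow> finite (B i)"
  shows "vector_space.dim (prod_scale scale) (coord_space J U) = (\<Sum>i\<in>J. card (B i))"
proof -
  interpret W: vector_space "prod_scale scale"
    by (rule vector_space_prod_scale) unfold_locales
  have "0 \<notin> B i" if "i \<in> J" for i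
    using basis[OF that] dependent_zero by (auto simp: is_basis_def)
  then have "card (coord_basis J B) = (\<Sum>i\<in>J. card (B i))"
    using assms by (intro card_coord_basis)
  moreover have "W.independent (coord_basis J B)" "W.span (coord_basis J B) = coord_space J U"
    using is_basis_coord_basis[OF assms(1) basis] by (auto simp: is_basis_def)
  ultimately show ?thesis
    using W.dim_eq_card[of "coord_basis J B" "coord_space J U"] by (metis W.span_span)
qed

end

section \<open>The annihilator of a quotient by an ideal\<close>

text \<open>
  This brings the annihilator series down from cosets to elements. The ideal property makes the
  product of two cosets a single coset, which is the zero coset exactly if the product of the
  representatives lies in \<open>I\<close>.
\<close>

lemma (in vector_space) annihilator_quotient:
  assumes sub: "subspace I" and subA: "subspace A" and IA: "I \<subseteq> A"
    and bil: "bilinear_map scale A A mul"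
    and ideal: "\<And>x y. x \<in> I \<Longrightarrow> y \<in> A \<Longrightarrow> mul x y \<in> I \<and> mul y x \<in> I"
  shows "{x\<in>A. x +o I \<in> annihilator (quot_carrier A I) (quot_mult mul I) I}
       = {x\<in>A. \<forall>y\<in>A. mul x y \<in> I \<and> mul y x \<in> I}"
proof -
  have coset_eq: "a +o I = b +o I" if "a - b \<in> I" for a b
  proof -
    have "a' +o I \<subseteq> b' +o I" if "a' - b' \<in> I" for a' b'
    proof
      fix w assume "w \<in> a' +o I"
      then have "(w - a') + (a' - b') \<in> I"
        using set_plus_imp_minus[of w a' I] that subspace_add[OF sub] by blast
      then show "w \<in> b' +o I"
        by (intro set_minus_imp_plus) simp
    qed
    moreover have "b - a \<in> I"
      using subspace_neg[OF sub that] by simp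
    ultimately show ?thesis
      using that by blast
  qed
  have coset_zero: "a +o I = I \<longleftrightarrow> a \<in> I" for a
  proof
    assume "a +o I = I"
    moreover have "a \<in> a +o I"
      using subspace_0[OF sub] by (auto simp: elt_set_plus_def intro: bexI[of _ 0])
    ultimately show "a \<in> I" by simp
  next
    assume "a \<in> I"
    then have "a +o I = 0 +o I" by (intro coset_eq) simp
    then show "a +o I = I" by simp
  qed
  have mult: "quot_mult mul I (x +o I) (y +o I) = mul x y +o I" if x: "x \<in> A" and y: "y \<in> A" for x y
  proof -
    have "mul (x + a) (y + b) +o I = mul x y +o I" if a: "a \<in> I" and b: "b \<in> I" for a b
    proof (rule coset_eq)
      have add: "mul (v + w) z = mul v z + mul w z" "mul z (v + w) = mul z v + mul z w"
        if "v \<in> A" "w \<in> A" "z \<in> A" for v w z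
        using bil that by (auto simp: bilinear_map_def)
      have A: "a \<in> A" "b \<in> A" "y + b \<in> A"
        using a b y IA subspace_add[OF subA] by auto
      have "mul (x + a) (y + b) - mul x y = mul x b + mul a (y + b)"
        using add x y A by simp
      also have "\<dots> \<in> I"
        using ideal a b x A by (intro subspace_add[OF sub]) auto
      finally show "mul (x + a) (y + b) - mul x y \<in> I" .
    qed
    then have "quot_mult mul I (x +o I) (y +o I) = (\<Union>a\<in>I. \<Union>b\<in>I. mul x y +o I)"
      by (fastforce simp: quot_mult_def elt_set_plus_def[of x] elt_set_plus_def[of y])
    then show ?thesis
      using subspace_0[OF sub] by auto
  qed
  have "x +o I \<in> annihilator (quot_carrier A I) (quot_mult mul I) I
      \<longleftrightarrow> (\<forall>y\<in>A. mul x y +o I = I \<and> mul y x +o I = I)" if "x \<in> A" for x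
    using that by (simp add: annihilator_def quot_carrier_def mult)
  then show ?thesis
    by (auto simp only: coset_zero)
qed

section \<open>The shift algebra and its filtration\<close>

locale shift_algebra = vector_space scale
  for scale :: "'f::field \<Rightarrow> 'v::ab_group_add \<Rightarrow> 'v" +
  fixes k :: nat and U :: "nat \<Rightarrow> 'v set" and \<xi> :: "nat \<Rightarrow> 'v \<Rightarrow> 'v \<Rightarrow> 'v"
  assumes subspace_factor: "\<And>i. i \<in> {1..k} \<Longrightarrow> subspace (U i)"
    and bilinear_factor: "\<And>i. i \<in> {1..<k} \<Longrightarrow> bilinear_map scale (U i) (U (i + 1)) (\<xi> i)"
begin

sublocale W: vector_space "prod_scale scale"
  by (rule vector_space_prod_scale) unfold_locales

abbreviation A :: "(nat \<Rightarrow> 'v) set" where "A \<equiv> prod_space k U"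

abbreviation mul :: "(nat \<Rightarrow> 'v) \<Rightarrow> (nat \<Rightarrow> 'v) \<Rightarrow> nat \<Rightarrow> 'v" where "mul \<equiv> shift_mult k \<xi>"

definition F :: "nat \<Rightarrow> (nat \<Rightarrow> 'v) set" where
  "F n = coord_space {Suc n..k} U"

lemma F_0: "F 0 = A"
  by (simp add: F_def prod_space_eq_coord_space)

lemma F_k: "F k = {0}"
  by (auto simp: F_def coord_space_def)

lemma component: "x \<in> A \<Longrightarrow> i \<in> {1..k} \<Longrightarrow> x i \<in> U i"
  by (simp add: prod_space_def)

lemma zero_in_factor: "i \<in> {1..k} \<Longrightarrow> 0 \<in> U i"
  by (intro subspace_0 subspace_factor)

lemma in_F_iff: "x \<in> F n \<longleftrightarrow> x \<in> A \<and> (\<forall>i\<in>{1..n}. x i = 0)"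
proof
  assume "x \<in> F n"
  then show "x \<in> A \<and> (\<forall>i\<in>{1..n}. x i = 0)"
    using zero_in_factor by (force simp: F_def prod_space_def coord_space_def not_less_eq_eq)
next
  assume x: "x \<in> A \<and> (\<forall>i\<in>{1..n}. x i = 0)"
  have "x i = 0" if "i \<notin> {Suc n..k}" for i
    using x that by (cases "i \<in> {1..n}") (auto simp: prod_space_def)
  then show "x \<in> F n"
    using x by (auto simp: F_def coord_space_def intro!: component)
qed

lemma subspace_F: "W.subspace (F n)"
  unfolding F_def by (intro subspace_coord_space subspace_factor) auto

lemma F_subset: "F n \<subseteq> A"
  by (auto simp: in_F_iff)

lemma factor_zero:
  assumes "i \<in> {1..<k}" "x \<in> U i"
  shows "\<xi> i 0 x = 0" "\<xi> i x 0 = 0"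
proof -
  have "0 \<in> U i"
    using assms by (intro zero_in_factor) auto
  moreover have "\<xi> i (scale 0 x) x = scale 0 (\<xi> i x x)" "\<xi> i x (scale 0 x) = scale 0 (\<xi> i x x)"
    using bilinear_factor[OF assms(1)] assms(2) unfolding bilinear_map_def by blast+
  ultimately show "\<xi> i 0 x = 0" "\<xi> i x 0 = 0"
    by simp_all
qed

lemma mul_in_A:
  assumes "x \<in> A" "y \<in> A"
  shows "mul x y \<in> A"
proof -
  have "\<xi> (i - 1) (x (i - 1)) (y (i - 1)) \<in> U i" if "i \<in> {2..k}" for i
  proof -
    have *: "i - 1 \<in> {1..<k}" "i - 1 + 1 = i" "i - 1 \<in> {1..k}" using that by auto
    then have "x (i - 1) \<in> U (i - 1)" "y (i - 1) \<in> U (i - 1)"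
      using assms component by auto
    then show ?thesis
      using bilinear_factor[OF *(1)] unfolding bilinear_map_def *(2) by blast
  qed
  then show ?thesis
    using zero_in_factor by (auto simp: prod_space_def shift_mult_def)
qed

lemma bilinear_mul: "bilinear_map (prod_scale scale) A A mul"
proof -
  have comp: "x (i - 1) \<in> U (i - 1)" if "x \<in> A" "i \<in> {2..k}" for x i
    using that by (intro component) auto
  have bil: "bilinear_map scale (U (i - 1)) (U (i - 1 + 1)) (\<xi> (i - 1))" if "i \<in> {2..k}" for i
    using that by (intro bilinear_factor) auto
  have "mul (x + y) z = mul x z + mul y z" "mul z (x + y) = mul z x + mul z y"
    if "x \<in> A" "y \<in> A" "z \<in> A" for x y z
    using bil comp that unfolding bilinear_map_def by (auto simp: shift_mult_def fun_eq_iff)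
  moreover have "mul (prod_scale scale c x) y = prod_scale scale c (mul x y)"
    "mul x (prod_scale scale c y) = prod_scale scale c (mul x y)"
    if "x \<in> A" "y \<in> A" for c x y
    using bil comp that unfolding bilinear_map_def
    by (auto simp: shift_mult_def prod_scale_def fun_eq_iff)
  ultimately show ?thesis
    unfolding bilinear_map_def using mul_in_A by blast
qed

lemma is_algebra_A: "is_algebra (prod_scale scale) A mul"
  unfolding is_algebra_def using bilinear_mul subspace_F[of 0] W.vector_space_axioms
  by (simp add: F_0)

lemma mul_in_F_Suc:
  assumes "x \<in> F n" "y \<in> A"
  shows "mul x y \<in> F (Suc n)" "mul y x \<in> F (Suc n)"
proof -
  have "x \<in> A" using assms(1) by (simp add: in_F_iff)
  moreover have "mul x y i = 0 \<and> mul y x i = 0" if "i \<in> {1..Suc n}" for i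
  proof (cases "i \<in> {2..k}")
    case True
    then have "i - 1 \<in> {1..<k}" "i - 1 \<in> {1..k}" "i - 1 \<in> {1..n}"
      using that by auto
    moreover from this have "y (i - 1) \<in> U (i - 1)" "x (i - 1) = 0"
      using assms by (auto simp: in_F_iff intro: component)
    ultimately show ?thesis
      using factor_zero by (simp add: shift_mult_def)
  qed (auto simp: shift_mult_def)
  ultimately show "mul x y \<in> F (Suc n)" "mul y x \<in> F (Suc n)"
    using assms(2) mul_in_A by (auto simp: in_F_iff[of _ "Suc n"])
qed

lemma F_Suc_subset: "F (Suc n) \<subseteq> F n"
  by (auto simp: in_F_iff)

section \<open>Nilpotency\<close>

abbreviation E :: "nat \<Rightarrow> (nat \<Rightarrow> 'v) set" where "E \<equiv> alg_power (prod_scale scale) A mul"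

lemma alg_power_subset: "E r \<subseteq> A"
proof (induction r rule: less_induct)
  case (less r)
  have "subspace_prod (prod_scale scale) mul (E i) (E (r - i)) \<subseteq> A" if "i \<in> {1..<r}" for i
    unfolding subspace_prod_def
    using less[of i] less[of "r - i"] that mul_in_A subspace_F[of 0]
    by (intro W.span_minimal) (auto simp: F_0 subset_iff)
  then have "W.span (\<Union>i\<in>{1..<r}. subspace_prod (prod_scale scale) mul (E i) (E (r - i))) \<subseteq> A"
    using subspace_F[of 0] by (intro W.span_minimal UN_least) (auto simp: F_0)
  then show ?case
    by (subst alg_power.simps) simp
qed

text \<open>
  Multiplying raises the weight by one however the factors are bracketed, and of two exponents with
  sum at least \<open>2 ^ Suc n\<close> one is at least \<open>2 ^ n\<close>.
\<close>

lemma alg_power_subset_F: "2 ^ n \<le> r \<Longrightarrow> E r \<subseteq> F n"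
proof (induction n arbitrary: r)
  case 0
  show ?case by (simp add: F_0 alg_power_subset)
next
  case (Suc n)
  have "subspace_prod (prod_scale scale) mul (E i) (E (r - i)) \<subseteq> F (Suc n)" if "i \<in> {1..<r}" for i
  proof -
    have "2 ^ n \<le> i \<or> 2 ^ n \<le> r - i"
      using Suc.prems by auto
    then have "E i \<subseteq> F n \<or> E (r - i) \<subseteq> F n"
      using Suc.IH by blast
    then show ?thesis
      unfolding subspace_prod_def using alg_power_subset mul_in_F_Suc subspace_F[of "Suc n"]
      by (intro W.span_minimal) blast+
  qed
  then have "W.span (\<Union>i\<in>{1..<r}. subspace_prod (prod_scale scale) mul (E i) (E (r - i))) \<subseteq> F (Suc n)"
    using subspace_F by (intro W.span_minimal UN_least)
  moreover have "\<not> r \<le> 1"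
    using Suc.prems one_le_power[of "2::nat" n] unfolding power_Suc by linarith
  ultimately show ?case
    by (subst alg_power.simps) simp
qed

lemma nilpotent_A: "nilpotent_algebra (prod_scale scale) A mul"
proof -
  have "0 \<in> E (2 ^ k)"
  proof (cases "2 ^ k \<le> (1::nat)")
    case True
    then show ?thesis
      using W.subspace_0[OF subspace_F[of 0]] by (simp add: alg_power.simps F_0)
  qed (simp add: alg_power.simps W.span_zero)
  then have "E (2 ^ k) = {0}"
    using alg_power_subset_F[of k "2 ^ k"] by (auto simp: F_k)
  then show ?thesis
    unfolding nilpotent_algebra_def by (intro exI[of _ "2 ^ k"]) simp
qed

section \<open>The natural basis\<close>

lemma evolution_A:
  assumes basis: "\<And>i. i \<in> {1..k} \<Longrightarrow> is_basis scale (U i) (B i)"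
    and orth: "\<And>i a b. i \<in> {1..<k} \<Longrightarrow> a \<in> B i \<Longrightarrow> b \<in> B i \<Longrightarrow> a \<noteq> b \<Longrightarrow> \<xi> i a b = 0"
  shows "evolution_algebra (prod_scale scale) A mul"
proof -
  have BU: "a \<in> U i" if "a \<in> B i" "i \<in> {1..k}" for a i
    using basis[OF that(2)] that(1) span_base by (auto simp: is_basis_def)
  have "mul (single i a) (single j b) = 0"
    if ne: "single i a \<noteq> single j b" and ij: "i \<in> {1..k}" "j \<in> {1..k}" and ab: "a \<in> B i" "b \<in> B j"
    for i j a b
  proof
    fix l
    show "mul (single i a) (single j b) l = 0 l"
    proof (cases "l \<in> {2..k}")
      case True
      then have l: "l - 1 \<in> {1..<k}" "l - 1 \<in> {1..k}" by auto
      then have "0 \<in> U (l - 1)" by (intro zero_in_factor)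
      then have "\<xi> (l - 1) (single i a (l - 1)) (single j b (l - 1)) = 0"
        using ne ab BU[of a i] BU[of b j] ij factor_zero[OF l(1)] orth[OF l(1), of a b]
        by (auto simp: single_def)
      with True show ?thesis by (simp add: shift_mult_def)
    qed (auto simp: shift_mult_def)
  qed
  then have "\<forall>x\<in>coord_basis {1..k} B. \<forall>y\<in>coord_basis {1..k} B. x \<noteq> y \<longrightarrow> mul x y = 0"
    by (auto simp: coord_basis_def)
  moreover have "is_basis (prod_scale scale) A (coord_basis {1..k} B)"
    unfolding prod_space_eq_coord_space by (intro is_basis_coord_basis basis) auto
  ultimately show ?thesis
    unfolding evolution_algebra_def using is_algebra_A by blast
qed

section \<open>The annihilator series\<close>

text \<open>
  Probing \<open>x\<close> with tuples that have a single nonzero component turns nondegeneracy of the factors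
  into a converse of the inclusion of \<open>F n A\<close> in \<open>F (Suc n)\<close>.
\<close>

lemma multiplier_F_Suc:
  assumes nondeg: "\<And>i. i \<in> {1..<k} \<Longrightarrow> nondegenerate (U i) (\<xi> i)" and "Suc n \<le> k"
  shows "{x\<in>A. \<forall>y\<in>A. mul x y \<in> F (Suc n) \<and> mul y x \<in> F (Suc n)} = F n"
proof
  show "F n \<subseteq> {x\<in>A. \<forall>y\<in>A. mul x y \<in> F (Suc n) \<and> mul y x \<in> F (Suc n)}"
    using mul_in_F_Suc F_subset by blast
next
  have "x i = 0" if x: "x \<in> A" "\<forall>y\<in>A. mul x y \<in> F (Suc n)" and i: "i \<in> {1..n}" for x i
  proof -
    have ik: "i \<in> {1..<k}" using i assms(2) by auto
    have "\<xi> i (x i) v = 0" if "v \<in> U i" for v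
    proof -
      have "single i v \<in> A"
        using \<open>v \<in> U i\<close> ik zero_in_factor by (auto simp: prod_space_def single_def)
      then have "mul x (single i v) (Suc i) = 0"
        using x(2) i by (auto simp: in_F_iff)
      then show ?thesis
        using ik by (simp add: shift_mult_def single_def)
    qed
    moreover have "x i \<in> U i"
      using x(1) ik by (intro component) auto
    ultimately show ?thesis
      using nondeg[OF ik] by (auto simp: nondegenerate_def)
  qed
  then show "{x\<in>A. \<forall>y\<in>A. mul x y \<in> F (Suc n) \<and> mul y x \<in> F (Suc n)} \<subseteq> F n"
    by (auto simp: in_F_iff[of _ n])
qed

lemma ann_series_eq_F:
  assumes nondeg: "\<And>i. i \<in> {1..<k} \<Longrightarrow> nondegenerate (U i) (\<xi> i)" and "t \<le> k"
  shows "ann_series A mul t = F (k - t)"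
  using \<open>t \<le> k\<close>
proof (induction t)
  case 0
  show ?case by (simp add: F_k)
next
  case (Suc t)
  define n where "n = k - Suc t"
  have n: "k - t = Suc n" "Suc n \<le> k" using Suc.prems by (auto simp: n_def)
  have "ann_series A mul (Suc t)
      = {x\<in>A. \<forall>y\<in>A. mul x y \<in> F (Suc n) \<and> mul y x \<in> F (Suc n)}"
    using Suc n subspace_F[of 0] mul_in_F_Suc F_Suc_subset
    by (simp add: F_0)
      (intro W.annihilator_quotient subspace_F F_subset bilinear_mul; blast)
  also have "\<dots> = F (k - Suc t)"
    using multiplier_F_Suc[OF _ n(2)] nondeg by (simp add: n_def)
  finally show ?case .
qed

lemma has_type_A:
  assumes nondeg: "\<And>i. i \<in> {1..<k} \<Longrightarrow> nondegenerate (U i) (\<xi> i)"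
    and "k \<ge> 1" and "U 1 \<noteq> {0}"
    and basis: "\<And>i. i \<in> {1..k} \<Longrightarrow> is_basis scale (U i) (B i)"
    and fin: "\<And>i. i \<in> {1..k} \<Longrightarrow> finite (B i)"
  shows "has_type (prod_scale scale) A mul (map (\<lambda>i. card (B (k - i + 1))) [1..<k + 1])"
proof -
  have dim_F: "W.dim (F n) = (\<Sum>i\<in>{Suc n..k}. card (B i))" for n
    unfolding F_def using basis fin by (intro dim_coord_space) auto
  have "is_basis (prod_scale scale) A (coord_basis {1..k} B)"
    unfolding prod_space_eq_coord_space by (intro is_basis_coord_basis basis) auto
  moreover have "finite (coord_basis {1..k} B)"
    using fin by (auto simp: coord_basis_def)
  ultimately have "finite_dimensional (prod_scale scale) A"
    by (auto simp: finite_dimensional_def)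
  moreover have "ann_series A mul k = A"
    using ann_series_eq_F[of k] nondeg by (simp add: F_0)
  moreover have "ann_series A mul t \<noteq> A" if "t < k" for t
  proof -
    obtain v where "v \<in> U 1" "v \<noteq> 0"
      using \<open>U 1 \<noteq> {0}\<close> \<open>k \<ge> 1\<close> zero_in_factor[of 1] by auto
    then have "single 1 v \<in> A" "single 1 v \<notin> F (k - t)"
      using zero_in_factor \<open>t < k\<close> by (auto simp: prod_space_def in_F_iff single_def)
    then show ?thesis
      using ann_series_eq_F[of t] nondeg \<open>t < k\<close> by auto
  qed
  moreover have "W.dim (ann_series A mul i) - W.dim (ann_series A mul (i - 1)) = card (B (k - i + 1))"
    if "i \<in> {1..k}" for i
  proof -
    \<comment> \<open>\<open>F (k - i)\<close> has exactly one factor more than \<open>F (k - (i - 1))\<close>, the one at \<open>k - i + 1\<close>.\<close>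
    have "W.dim (F (k - i)) = card (B (k - i + 1)) + W.dim (F (k - (i - 1)))"
      unfolding dim_F using that by (subst sum.atLeast_Suc_atMost) (auto simp: Suc_diff_le)
    then show ?thesis
      using that ann_series_eq_F[OF nondeg, of i] ann_series_eq_F[OF nondeg, of "i - 1"] by auto
  qed
  ultimately show ?thesis
    unfolding has_type_def using is_algebra_A nilpotent_A
    by (intro conjI exI[of _ k]) auto
qed

end

section \<open>Type of the product algebra\<close>

theorem theorem4:
  fixes scale :: "'f::field \<Rightarrow> 'v::ab_group_add \<Rightarrow> 'v"
    and k :: nat
    and U :: "nat \<Rightarrow> 'v set"
    and m :: "nat \<Rightarrow> nat"
    and u :: "nat \<Rightarrow> nat \<Rightarrow> 'v"
    and \<xi> :: "nat \<Rightarrow> 'v \<Rightarrow> 'v \<Rightarrow> 'v"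
  assumes "CHAR('f) \<noteq> 2"
    and "vector_space scale"
    and "k \<ge> 1"
    and "\<And>i. i \<in> {1..k} \<Longrightarrow> module.subspace scale (U i)"
    and "\<And>i. i \<in> {1..k} \<Longrightarrow> vector_space.dim scale (U i) = m i"
    and "\<And>i. i \<in> {1..k} \<Longrightarrow> inj_on (u i) {1..m i}"
    and "\<And>i. i \<in> {1..k} \<Longrightarrow> is_basis scale (U i) (u i ` {1..m i})"
    and "\<And>i. i \<in> {1..<k} \<Longrightarrow> bilinear_map scale (U i) (U (i + 1)) (\<xi> i)"
    and "\<And>i. i \<in> {1..<k} \<Longrightarrow> symmetric_map (U i) (\<xi> i)"
    and "\<And>i p q. i \<in> {1..<k} \<Longrightarrow> p \<in> {1..m i} \<Longrightarrow> q \<in> {1..m i} \<Longrightarrow> p \<noteq> q \<Longrightarrow>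
           \<xi> i (u i p) (u i q) = 0"
  shows "evolution_algebra (prod_scale scale) (prod_space k U) (shift_mult k \<xi>)
       \<and> nilpotent_algebra (prod_scale scale) (prod_space k U) (shift_mult k \<xi>)
       \<and> (m 1 \<ge> 1 \<and> (\<forall>i\<in>{1..<k}. nondegenerate (U i) (\<xi> i)) \<longrightarrow>
            has_type (prod_scale scale) (prod_space k U) (shift_mult k \<xi>)
              (map (\<lambda>i. m (k - i + 1)) [1..<k + 1]))"
proof -
  define B where "B i = u i ` {1..m i}" for i
  interpret shift_algebra scale k U \<xi>
    using assms(2,4,8) by (simp add: shift_algebra_def shift_algebra_axioms_def)
  have basis: "is_basis scale (U i) (B i)" if "i \<in> {1..k}" for i
    using assms(7)[OF that] by (simp add: B_def)
  have card: "card (B i) = m i" if "i \<in> {1..k}" for i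
    using assms(6)[OF that] by (simp add: B_def card_image)
  have "evolution_algebra (prod_scale scale) (prod_space k U) (shift_mult k \<xi>)"
  proof (rule evolution_A[of B])
    show "\<xi> i a b = 0" if "i \<in> {1..<k}" "a \<in> B i" "b \<in> B i" "a \<noteq> b" for i a b
      using assms(10)[OF that(1)] that(2-4) unfolding B_def by blast
  qed (rule basis)
  moreover have "has_type (prod_scale scale) (prod_space k U) (shift_mult k \<xi>)
      (map (\<lambda>i. m (k - i + 1)) [1..<k + 1])"
    if "m 1 \<ge> 1" and nondeg: "\<forall>i\<in>{1..<k}. nondegenerate (U i) (\<xi> i)"
  proof -
    have "1 \<in> {1..k}" using assms(3) by simp
    have "U 1 \<noteq> {0}"
    proof
      assume "U 1 = {0}"
      then have "dim (U 1) = 0"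
        using dim_span_eq_card_independent[of "{}"] independent_empty by simp
      with assms(5)[OF \<open>1 \<in> {1..k}\<close>] \<open>m 1 \<ge> 1\<close> show False by simp
    qed
    then have "has_type (prod_scale scale) (prod_space k U) (shift_mult k \<xi>)
        (map (\<lambda>i. card (B (k - i + 1))) [1..<k + 1])"
      using nondeg assms(3) basis by (intro has_type_A) (auto simp: B_def)
    moreover have "map (\<lambda>i. card (B (k - i + 1))) [1..<k + 1] = map (\<lambda>i. m (k - i + 1)) [1..<k + 1]"
      by (auto simp: card)
    ultimately show ?thesis by metis
  qed
  ultimately show ?thesis
    using nilpotent_A by blast
qed

end
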